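(* Let $B_1$ be the graph on vertex set $\{0,1,\ldots,17\}$ with edge set $\{01, 0\,5, 0\,16, 12, 1\,17, 23, 2\,14, 34, 38, 45, 4\,17, 56, 67, 6\,11, 78, 7\,17, 89, 9\,10, 9\,13, 10\,11, 10\,15, 11\,12, 12\,13, 12\,16, 13\,14, 14\,15, 15\,16\}$, i.e. edges $(0,1),(0,5),(0,16),(1,2),(1,17),(2,3),(2,14),(3,4),(3,8),(4,5),(4,17),(5,6),(6,7),(6,11),(7,8),(7,17),(8,9),(9,10),(9,13),(10,11),(10,15),(11,12),(12,13),(12,16),(13,14),(14,15),(15,16)$ (the first Blanuša snark). Then $23 \le \pi(B_1) \le 28$.
   Context: A pebble distribution on a graph $G=(V,E)$ is a function $C:V\to\mathbb{Z}_{\ge 0}$, with size $|C|=\sum_v C(v)$. A pebbling move removes two pebbles from a vertex $u$ and places one pebble on a neighbour $v$ of $u$. A distribution $C$ is $r$-solvable if some sequence of pebbling moves ends with at least one pebble on $r$. The pebbling number $\pi(G,r)$ is the smallest integer $t$ such that every distribution of size $t$ is $r$-solvable, and $\pi(G)=\max_{r\in V}\pi(G,r)$. *)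

theory Defs
  imports Main
begin

text \<open>
  A graph is given by its vertex set \<open>V\<close> and its edge set \<open>E\<close>, a set of two-element subsets of \<open>V\<close>.
  A pebble distribution \<open>V \<rightarrow> nat\<close> is represented by a total function vanishing outside \<open>V\<close>.
\<close>

definition simple_graph :: "'a set \<Rightarrow> 'a set set \<Rightarrow> bool" where
  "simple_graph V E \<longleftrightarrow> finite V \<and> (\<forall>e\<in>E. e \<subseteq> V \<and> card e = 2)"

definition pebble_distribution :: "'a set \<Rightarrow> ('a \<Rightarrow> nat) \<Rightarrow> bool" where
  "pebble_distribution V C \<longleftrightarrow> (\<forall>v. v \<notin> V \<longrightarrow> C v = 0)"

definition pebble_size :: "'a set \<Rightarrow> ('a \<Rightarrow> nat) \<Rightarrow> nat" where
  "pebble_size V C = (\<Sum>v\<in>V. C v)"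

inductive pebbling_move :: "'a set set \<Rightarrow> ('a \<Rightarrow> nat) \<Rightarrow> ('a \<Rightarrow> nat) \<Rightarrow> bool"
  for E :: "'a set set" where
  "{u, v} \<in> E \<Longrightarrow> u \<noteq> v \<Longrightarrow> C u \<ge> 2 \<Longrightarrow>
     pebbling_move E C (C(u := C u - 2, v := C v + 1))"

definition solvable :: "'a set set \<Rightarrow> 'a \<Rightarrow> ('a \<Rightarrow> nat) \<Rightarrow> bool" where
  "solvable E r C \<longleftrightarrow> (\<exists>C'. (pebbling_move E)\<^sup>*\<^sup>* C C' \<and> C' r \<ge> 1)"

text \<open>
  \<open>LEAST\<close> is only meaningful if some \<open>t\<close> has the property, which is the case for finite connected
  graphs.
\<close>

definition rooted_pebbling_number :: "'a set \<Rightarrow> 'a set set \<Rightarrow> 'a \<Rightarrow> nat" where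
  "rooted_pebbling_number V E r =
     (LEAST t. \<forall>C. pebble_distribution V C \<and> pebble_size V C = t \<longrightarrow> solvable E r C)"

definition pebbling_number :: "'a set \<Rightarrow> 'a set set \<Rightarrow> nat" where
  "pebbling_number V E = Max (rooted_pebbling_number V E ` V)"

definition blanusa1_verts :: "nat set" where
  "blanusa1_verts = {0..17}"

definition blanusa1_edges :: "nat set set" where
  "blanusa1_edges =
     {{0, 1}, {0, 5}, {0, 16}, {1, 2}, {1, 17}, {2, 3}, {2, 14}, {3, 4}, {3, 8},
      {4, 5}, {4, 17}, {5, 6}, {6, 7}, {6, 11}, {7, 8}, {7, 17}, {8, 9}, {9, 10},
      {9, 13}, {10, 11}, {10, 15}, {11, 12}, {12, 13}, {12, 16}, {13, 14}, {14, 15},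
      {15, 16}}"

lemma simple_graph_blanusa1: "simple_graph blanusa1_verts blanusa1_edges"
  by (auto simp: simple_graph_def blanusa1_verts_def blanusa1_edges_def)

end

(*
  Upper bound: if every vertex of positive weight has a neighbour that is the root or has at least
  twice its weight, then an unsolvable distribution weighs at most as much as the distribution with
  one pebble everywhere. For one root in each orbit of the automorphism group, a positive
  combination of a few such weight functions (found by linear programming) bounds the size of an
  unsolvable distribution by 27.

  Lower bound: the distribution with 11, 9, 1, 1 pebbles on 12, 13, 10, 15 does not reach the
  vertex 4. Otherwise two pebbles would meet on one of its neighbours 3, 5, 17, and for each of them
  there is a potential that no move increases and that is too small initially.
*)
theory Submission
  imports Defs
begin

section \<open>Pebbling moves and solvability\<close>

lemma simple_graph_edgeD:
  assumes "simple_graph V E" "{u, v} \<in> E"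
  shows "u \<in> V" "v \<in> V"
  using assms by (auto simp: simple_graph_def)

text \<open>Written additively so that no truncated subtraction occurs. The entry function
  \<open>f\<close> is later the number of pebbles, their weight, or their potential.\<close>

lemma sum_fun_upd_two:
  fixes f :: "'a \<Rightarrow> nat \<Rightarrow> nat"
  assumes "finite V" "u \<in> V" "v \<in> V" "u \<noteq> v"
  shows "(\<Sum>x\<in>V. f x ((C(u := a, v := b)) x)) + f u (C u) + f v (C v)
       = (\<Sum>x\<in>V. f x (C x)) + f u a + f v b"
proof -
  have split: "(\<Sum>x\<in>V. g x) = g u + g v + (\<Sum>x\<in>V - {u} - {v}. g x)" for g :: "'a \<Rightarrow> nat"
    using assms by (simp add: sum.remove[of V u] sum.remove[of "V - {u}" v])
  have "(\<Sum>x\<in>V - {u} - {v}. f x ((C(u := a, v := b)) x)) = (\<Sum>x\<in>V - {u} - {v}. f x (C x))"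
    by (rule sum.cong) auto
  then show ?thesis
    using \<open>u \<noteq> v\<close> by (simp add: split)
qed

lemma solvable_if_pebble: "C r \<ge> 1 \<Longrightarrow> solvable E r C"
  by (auto simp: solvable_def)

lemma solvable_if_move:
  assumes "pebbling_move E C C'" "solvable E r C'"
  shows "solvable E r C"
  using assms by (auto simp: solvable_def intro: converse_rtranclp_into_rtranclp)

lemma pebbling_move_mono:
  assumes "pebbling_move E C C'" "C \<le> D"
  shows "\<exists>D'. pebbling_move E D D' \<and> C' \<le> D'"
  using assms(1)
proof cases
  case (1 u v)
  have le: "C x \<le> D x" for x
    using \<open>C \<le> D\<close> by (simp add: le_fun_def)
  have "pebbling_move E D (D(u := D u - 2, v := D v + 1))"
    using 1 le[of u] by (intro pebbling_move.intros) auto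
  moreover have "C' \<le> D(u := D u - 2, v := D v + 1)"
    using le by (auto simp: 1 le_fun_def intro: diff_le_mono)
  ultimately show ?thesis
    by blast
qed

lemma solvable_mono:
  assumes "solvable E r C" "C \<le> D"
  shows "solvable E r D"
proof -
  obtain C' where "(pebbling_move E)\<^sup>*\<^sup>* C C'" "C' r \<ge> 1"
    using assms(1) by (auto simp: solvable_def)
  then show ?thesis
    using \<open>C \<le> D\<close>
  proof (induction arbitrary: D rule: converse_rtranclp_induct)
    case base
    then show ?case
      by (meson le_fun_def order_trans solvable_if_pebble)
  next
    case (step C C1)
    then show ?case
      by (meson pebbling_move_mono solvable_if_move)
  qed
qed

definition all_solvable :: "'a set \<Rightarrow> 'a set set \<Rightarrow> 'a \<Rightarrow> nat \<Rightarrow> bool" where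
  "all_solvable V E r t \<longleftrightarrow>
     (\<forall>C. pebble_distribution V C \<and> pebble_size V C = t \<longrightarrow> solvable E r C)"

text \<open>Taking away one pebble gives a solvable distribution of size \<open>t\<close>, and
  putting it back cannot hurt.\<close>

lemma all_solvable_Suc:
  assumes "finite V" "all_solvable V E r t"
  shows "all_solvable V E r (Suc t)"
  unfolding all_solvable_def
proof (intro allI impI)
  fix C
  assume C: "pebble_distribution V C \<and> pebble_size V C = Suc t"
  then obtain v where v: "v \<in> V" "C v > 0"
    unfolding pebble_size_def by (metis gr0I sum.neutral Zero_not_Suc)
  let ?D = "C(v := C v - 1)"
  have "(\<Sum>x\<in>V - {v}. ?D x) = (\<Sum>x\<in>V - {v}. C x)"
    by (rule sum.cong) auto
  then have "pebble_size V ?D = t"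
    using C v \<open>finite V\<close> by (simp add: pebble_size_def sum.remove[of V v])
  moreover have "pebble_distribution V ?D"
    using C v by (auto simp: pebble_distribution_def)
  ultimately have "solvable E r ?D"
    using assms(2) by (simp add: all_solvable_def)
  then show "solvable E r C"
    by (rule solvable_mono) (simp add: le_fun_def)
qed

lemma all_solvable_mono:
  assumes "finite V" "all_solvable V E r s" "s \<le> t"
  shows "all_solvable V E r t"
  using assms(3,2) by (induction rule: dec_induct) (auto intro: all_solvable_Suc[OF assms(1)])

lemma rooted_pebbling_number_eq_Least:
  "rooted_pebbling_number V E r = (LEAST t. all_solvable V E r t)"
  unfolding rooted_pebbling_number_def all_solvable_def ..

lemma rooted_pebbling_number_le:
  "all_solvable V E r t \<Longrightarrow> rooted_pebbling_number V E r \<le> t"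
  unfolding rooted_pebbling_number_eq_Least by (rule Least_le)

text \<open>The size \<open>s\<close> guarantees that the \<open>LEAST\<close> is attained; without
  it the value would be unspecified.\<close>

lemma rooted_pebbling_number_gt:
  assumes "finite V" "all_solvable V E r s" "\<not> all_solvable V E r t"
  shows "t < rooted_pebbling_number V E r"
proof -
  have "all_solvable V E r (rooted_pebbling_number V E r)"
    unfolding rooted_pebbling_number_eq_Least using assms(2) by (rule LeastI)
  then show ?thesis
    using all_solvable_mono[OF assms(1)] assms(3) by (meson not_le)
qed

section \<open>Transport along automorphisms of order two\<close>

lemma pebbling_move_automorphism:
  assumes "\<And>x. \<phi> (\<phi> x) = x" "\<And>e. e \<in> E \<Longrightarrow> \<phi> ` e \<in> E" "pebbling_move E C C'"
  shows "pebbling_move E (C \<circ> \<phi>) (C' \<circ> \<phi>)"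
  using assms(3)
proof cases
  case (1 u v)
  have eq_iff: "\<phi> x = y \<longleftrightarrow> x = \<phi> y" for x y
    using assms(1) by metis
  have "C' \<circ> \<phi> = (C \<circ> \<phi>)(\<phi> u := (C \<circ> \<phi>) (\<phi> u) - 2, \<phi> v := (C \<circ> \<phi>) (\<phi> v) + 1)"
    by (auto simp: 1 fun_eq_iff eq_iff assms(1))
  moreover have "{\<phi> u, \<phi> v} \<in> E"
    using assms(2)[OF \<open>{u, v} \<in> E\<close>] by simp
  moreover have "\<phi> u \<noteq> \<phi> v"
    using \<open>u \<noteq> v\<close> by (simp add: eq_iff assms(1))
  moreover have "(C \<circ> \<phi>) (\<phi> u) \<ge> 2"
    using 1 by (simp add: assms(1))
  ultimately show ?thesis
    using pebbling_move.intros by metis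
qed

lemma all_solvable_automorphism:
  assumes inv: "\<And>x. \<phi> (\<phi> x) = x" and E: "\<And>e. e \<in> E \<Longrightarrow> \<phi> ` e \<in> E"
    and V: "\<phi> ` V \<subseteq> V" and r: "all_solvable V E r t"
  shows "all_solvable V E (\<phi> r) t"
  unfolding all_solvable_def
proof (intro allI impI)
  fix C
  assume C: "pebble_distribution V C \<and> pebble_size V C = t"
  have "bij_betw \<phi> V V"
    by (rule bij_betw_byWitness[where f' = \<phi>]) (use inv V in auto)
  then have "pebble_size V (C \<circ> \<phi>) = t"
    using C by (simp add: pebble_size_def sum.reindex_bij_betw)
  moreover have "pebble_distribution V (C \<circ> \<phi>)"
    using C V unfolding pebble_distribution_def by (metis comp_apply image_subset_iff inv)
  ultimately obtain D where "(pebbling_move E)\<^sup>*\<^sup>* (C \<circ> \<phi>) D" "D r \<ge> 1"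
    using r by (auto simp: all_solvable_def solvable_def)
  \<comment> \<open>Leaving \<open>C \<circ> \<phi>\<close> intact inside this expression lets the
    induction generalise over it as the starting distribution.\<close>
  then have "solvable E (\<phi> r) (C \<circ> \<phi> \<circ> \<phi>)"
  proof (induction rule: converse_rtranclp_induct)
    case base
    then show ?case
      by (intro solvable_if_pebble) (simp add: inv)
  next
    case (step C C1)
    then show ?case
      by (meson pebbling_move_automorphism[OF inv E] solvable_if_move)
  qed
  then show "solvable E (\<phi> r) C"
    by (simp add: comp_def inv)
qed

section \<open>Weight functions\<close>

text \<open>A local form of Hurlbert's tree strategies: following the vertices \<open>u\<close>
  leads to the root, with weights at least doubling before it is reached. A neighbour of the root
  may have any weight.\<close>

definition weight_strategy :: "'a set \<Rightarrow> 'a set set \<Rightarrow> 'a \<Rightarrow> ('a \<Rightarrow> nat) \<Rightarrow> bool" where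
  "weight_strategy V E r w \<longleftrightarrow>
     (\<forall>v\<in>V. w v > 0 \<longrightarrow> (\<exists>u. {v, u} \<in> E \<and> (u = r \<or> 2 * w v \<le> w u)))"

text \<open>
  An excess of weight yields a vertex with two pebbles, which can be moved without loss of weight
  towards the root; the number of pebbles drops.
\<close>

lemma weight_strategy_solvable:
  assumes G: "simple_graph V E" and w: "weight_strategy V E r w"
    and "(\<Sum>v\<in>V. w v) < (\<Sum>v\<in>V. w v * C v)"
  shows "solvable E r C"
  using assms(3)
proof (induction "pebble_size V C" arbitrary: C rule: less_induct)
  case less
  have "finite V"
    using G by (simp add: simple_graph_def)
  obtain v where v: "v \<in> V" "w v < w v * C v"
    using less.prems by (meson sum_mono not_le)
  then have "w v * 1 < w v * C v"
    by simp
  then have "w v > 0" "C v \<ge> 2"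
    unfolding mult_less_cancel1 by auto
  then obtain u where u: "{v, u} \<in> E" "u = r \<or> 2 * w v \<le> w u"
    using w v by (auto simp: weight_strategy_def)
  then have "u \<in> V" "v \<noteq> u"
    using G by (auto simp: simple_graph_def)
  let ?C = "C(v := C v - 2, u := C u + 1)"
  have move: "pebbling_move E C ?C"
    using u \<open>v \<noteq> u\<close> \<open>C v \<ge> 2\<close> by (intro pebbling_move.intros)
  have "solvable E r ?C"
  proof (cases "u = r")
    case True
    then show ?thesis
      by (intro solvable_if_pebble) simp
  next
    case False
    note upd = sum_fun_upd_two[OF \<open>finite V\<close> \<open>v \<in> V\<close> \<open>u \<in> V\<close> \<open>v \<noteq> u\<close>]
    have "pebble_size V ?C < pebble_size V C"
      using upd[of "\<lambda>_ c. c" C "C v - 2" "C u + 1"] \<open>C v \<ge> 2\<close> by (simp add: pebble_size_def)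
    moreover have "(\<Sum>x\<in>V. w x * C x) \<le> (\<Sum>x\<in>V. w x * ?C x)"
    proof -
      \<comment> \<open>The move loses \<open>2 * w v\<close> at \<open>v\<close> and gains
        \<open>w u\<close> at \<open>u\<close>, which is at least as much since \<open>u\<close> is
        not the root.\<close>
      have "w v * C v = w v * (C v - 2) + 2 * w v"
        using \<open>C v \<ge> 2\<close> by (metis add_mult_distrib2 le_add_diff_inverse2 mult.commute)
      then show ?thesis
        using upd[of "\<lambda>x c. w x * c" C "C v - 2" "C u + 1"] u False by (simp add: algebra_simps)
    qed
    ultimately show ?thesis
      using less by simp
  qed
  then show ?case
    by (rule solvable_if_move[OF move])
qed

text \<open>A linear programming certificate with denominators cleared: the \<open>q\<close> are
  multipliers and \<open>L\<close> is the common scale. The root needs no covering because an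
  unsolvable distribution has no pebble there.\<close>

lemma all_solvable_if_weight_strategies:
  assumes G: "simple_graph V E"
    and strategies: "\<forall>(q, w)\<in>set qs. weight_strategy V E r w"
    and lower: "\<forall>v\<in>V. v = r \<or> L \<le> (\<Sum>(q, w)\<leftarrow>qs. q * w v)"
    and upper: "(\<Sum>(q, w)\<leftarrow>qs. q * (\<Sum>v\<in>V. w v)) < L * t"
  shows "all_solvable V E r t"
  unfolding all_solvable_def
proof (intro allI impI, rule ccontr)
  fix C
  assume C: "pebble_distribution V C \<and> pebble_size V C = t" and uns: "\<not> solvable E r C"
  have "C r = 0"
    using uns solvable_if_pebble[of C r E] by (cases "C r") auto
  have "L * t = (\<Sum>v\<in>V. L * C v)"
    using C by (auto simp: pebble_size_def sum_distrib_left)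
  also have "\<dots> \<le> (\<Sum>v\<in>V. (\<Sum>(q, w)\<leftarrow>qs. q * w v) * C v)"
  proof (rule sum_mono)
    fix v assume "v \<in> V"
    then show "L * C v \<le> (\<Sum>(q, w)\<leftarrow>qs. q * w v) * C v"
      using lower \<open>C r = 0\<close> by (cases "v = r") auto
  qed
  also have "\<dots> \<le> (\<Sum>(q, w)\<leftarrow>qs. q * (\<Sum>v\<in>V. w v))"
    using strategies
  proof (induction qs)
    case Nil
    then show ?case by simp
  next
    case (Cons qw qs)
    obtain q w where qw: "qw = (q, w)"
      by fastforce
    have "(\<Sum>v\<in>V. w v * C v) \<le> (\<Sum>v\<in>V. w v)"
      using weight_strategy_solvable[OF G, of r w C] Cons.prems uns qw by (auto simp: not_less[symmetric])
    then have "(\<Sum>v\<in>V. q * w v * C v) \<le> q * (\<Sum>v\<in>V. w v)"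
      by (simp add: mult.assoc flip: sum_distrib_left)
    then show ?case
      using Cons by (simp add: qw distrib_right sum.distrib add_mono)
  qed
  finally show False
    using upper by simp
qed

section \<open>Potentials\<close>

text \<open>
  The potential of a vertex grows alternately by \<open>M\<close> (second pebble of a pair) and \<open>m - M\<close>
  (first pebble of a pair). It is linear for \<open>m = 2 * M\<close>, while \<open>m = M\<close> ignores an unpaired pebble.
\<close>

definition paired_potential :: "nat \<Rightarrow> nat \<Rightarrow> nat \<Rightarrow> nat" where
  "paired_potential m M c = m * (c div 2) + (m - M) * (c mod 2)"

text \<open>The increment is \<open>m - M\<close> from an even count and \<open>M\<close> from an
  odd one; \<open>m \<le> 2 * M\<close> bounds the former by \<open>M\<close>.\<close>

lemma paired_potential_Suc:
  assumes "M \<le> m" "m \<le> 2 * M"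
  shows "paired_potential m M (Suc c) \<le> paired_potential m M c + M"
proof (cases "even c")
  case True
  then obtain k where "c = 2 * k" ..
  then show ?thesis
    using assms by (simp add: paired_potential_def)
next
  case False
  then obtain k where "c = 2 * k + 1"
    by (elim oddE)
  then show ?thesis
    using assms by (simp add: paired_potential_def)
qed

lemma paired_potential_add_2: "paired_potential m M (c + 2) = paired_potential m M c + m"
  by (simp add: paired_potential_def)

lemma paired_potential_ge:
  assumes "M \<le> m" "2 \<le> c"
  shows "m \<le> paired_potential m M c"
proof -
  have "1 \<le> c div 2"
    using assms(2) by linarith
  then show ?thesis
    unfolding paired_potential_def by (metis mult.right_neutral mult_le_mono2 trans_le_add1)
qed

text \<open>A move loses exactly \<open>m u\<close> at its source, whatever the parity there, and
  gains at most \<open>M v\<close> at its target.\<close>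

lemma pebbling_moves_potential_le:
  assumes G: "simple_graph V E"
    and m: "\<forall>v\<in>V. M v \<le> m v \<and> m v \<le> 2 * M v"
    and edge: "\<And>u v. {u, v} \<in> E \<Longrightarrow> M v \<le> m u"
    and "(pebbling_move E)\<^sup>*\<^sup>* C C'"
  shows "(\<Sum>v\<in>V. paired_potential (m v) (M v) (C' v)) \<le> (\<Sum>v\<in>V. paired_potential (m v) (M v) (C v))"
  using assms(4)
proof induction
  case base
  show ?case by simp
next
  case (step C1 C2)
  from step.hyps(2) show ?case
  proof cases
    case (1 u v)
    have uv: "u \<in> V" "v \<in> V" and "finite V"
      using G simple_graph_edgeD[OF G \<open>{u, v} \<in> E\<close>] by (auto simp: simple_graph_def)
    let ?f = "\<lambda>x. paired_potential (m x) (M x)"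
    have "?f v (C1 v + 1) \<le> ?f v (C1 v) + M v"
      using paired_potential_Suc m uv by simp
    moreover have "?f u (C1 u) = ?f u (C1 u - 2) + m u"
      using paired_potential_add_2[of "m u" "M u" "C1 u - 2"] \<open>C1 u \<ge> 2\<close>
      by (simp only: le_add_diff_inverse2)
    ultimately have "(\<Sum>x\<in>V. ?f x (C2 x)) \<le> (\<Sum>x\<in>V. ?f x (C1 x))"
      using sum_fun_upd_two[OF \<open>finite V\<close> uv \<open>u \<noteq> v\<close>, of ?f C1 "C1 u - 2" "C1 v + 1"]
        edge[OF \<open>{u, v} \<in> E\<close>] unfolding 1(1) by linarith
    then show ?thesis
      using step.IH by simp
  qed
qed

text \<open>The first pebble on \<open>r\<close> comes from a neighbour that held two pebbles just
  before.\<close>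

lemma solvable_obtain_neighbour:
  assumes "solvable E r C" "C r = 0"
  obtains u C' where "(pebbling_move E)\<^sup>*\<^sup>* C C'" "{u, r} \<in> E" "C' u \<ge> 2"
proof -
  obtain D where D: "(pebbling_move E)\<^sup>*\<^sup>* C D" "D r \<ge> 1"
    using assms(1) by (auto simp: solvable_def)
  from D(1) have "D r = 0 \<or> (\<exists>u C'. (pebbling_move E)\<^sup>*\<^sup>* C C' \<and> {u, r} \<in> E \<and> C' u \<ge> 2)"
  proof induction
    case base
    then show ?case
      using assms(2) by simp
  next
    case (step C1 C2)
    from step.hyps(2) step.IH step.hyps(1) show ?case
      by cases (auto split: if_splits)
  qed
  then show thesis
    using D(2) that by auto
qed

section \<open>The first Blanusa snark\<close>

text \<open>Adjacency lists turn the conditions on neighbours into finite checks for the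
  simplifier.\<close>

definition blanusa1_nbrs :: "nat list list" where
  "blanusa1_nbrs =
     [[1, 5, 16], [0, 2, 17], [1, 3, 14], [2, 4, 8], [3, 5, 17], [0, 4, 6],
      [5, 7, 11], [6, 8, 17], [3, 7, 9], [8, 10, 13], [9, 11, 15], [6, 10, 12],
      [11, 13, 16], [9, 12, 14], [2, 13, 15], [10, 14, 16], [0, 12, 15], [1, 4, 7]]"

lemma blanusa1_verts_eq:
  "blanusa1_verts = {0, 1, 2, 3, 4, 5, 6, 7, 8, 9, 10, 11, 12, 13, 14, 15, 16, 17}"
  unfolding blanusa1_verts_def by code_simp

lemma blanusa1_edge_iff:
  assumes "v \<in> blanusa1_verts"
  shows "{v, u} \<in> blanusa1_edges \<longleftrightarrow> u \<in> set (blanusa1_nbrs ! v)"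
  using assms unfolding blanusa1_verts_eq
  by (elim insertE emptyE) (simp_all add: blanusa1_edges_def blanusa1_nbrs_def doubleton_eq_iff)

lemma all_solvable_blanusa1_if_weights:
  assumes "\<forall>(q, w)\<in>set qs. \<forall>v\<in>blanusa1_verts.
      w v > 0 \<longrightarrow> (\<exists>u\<in>set (blanusa1_nbrs ! v). u = r \<or> 2 * w v \<le> w u)"
    and "\<forall>v\<in>blanusa1_verts. v = r \<or> L \<le> (\<Sum>(q, w)\<leftarrow>qs. q * w v)"
    and "(\<Sum>(q, w)\<leftarrow>qs. q * (\<Sum>v\<in>blanusa1_verts. w v)) < L * t"
  shows "all_solvable blanusa1_verts blanusa1_edges r t"
proof (rule all_solvable_if_weight_strategies[OF simple_graph_blanusa1 _ assms(2,3)])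
  show "\<forall>(q, w)\<in>set qs. weight_strategy blanusa1_verts blanusa1_edges r w"
  proof safe
    fix q w
    assume "(q, w) \<in> set qs"
    then have "\<forall>v\<in>blanusa1_verts.
        w v > 0 \<longrightarrow> (\<exists>u\<in>set (blanusa1_nbrs ! v). u = r \<or> 2 * w v \<le> w u)"
      using assms(1) by blast
    then show "weight_strategy blanusa1_verts blanusa1_edges r w"
      unfolding weight_strategy_def using blanusa1_edge_iff by blast
  qed
qed

section \<open>Upper bound: certificates for one root per orbit\<close>

text \<open>For the roots 0, 1, 4, 9, 10 the combined weights total 216, 220, 1160, 424, 808,
  against \<open>L * 28\<close> = 224, 224, 1176, 448, 840.\<close>

lemma all_solvable_blanusa1_0: "all_solvable blanusa1_verts blanusa1_edges 0 28"
  by (rule all_solvable_blanusa1_if_weights[where L = 8 and qs =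
    "[(1, (!) [0, 0, 0, 4, 8, 16, 8, 4, 2, 1, 0, 0, 0, 0, 0, 0, 0, 0]),
      (1, (!) [0, 16, 8, 4, 0, 0, 0, 0, 2, 1, 0, 0, 0, 0, 4, 0, 0, 0]),
      (2, (!) [0, 0, 0, 0, 0, 0, 0, 0, 1, 2, 2, 4, 8, 4, 0, 0, 16, 0]),
      (1, (!) [0, 16, 0, 0, 0, 0, 0, 4, 2, 2, 4, 0, 0, 0, 4, 8, 16, 8])]"])
    (simp_all add: blanusa1_verts_eq blanusa1_nbrs_def)

lemma all_solvable_blanusa1_1: "all_solvable blanusa1_verts blanusa1_edges 1 28"
  by (rule all_solvable_blanusa1_if_weights[where L = 8 and qs =
    "[(1, (!) [0, 0, 16, 0, 0, 0, 0, 0, 0, 2, 2, 0, 0, 4, 8, 4, 0, 0]),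
      (2, (!) [0, 0, 0, 4, 8, 4, 4, 8, 4, 2, 1, 2, 0, 0, 0, 0, 0, 16]),
      (2, (!) [16, 0, 0, 0, 0, 0, 0, 0, 0, 1, 2, 2, 4, 2, 0, 4, 8, 0])]"])
    (simp_all add: blanusa1_verts_eq blanusa1_nbrs_def)

lemma all_solvable_blanusa1_4: "all_solvable blanusa1_verts blanusa1_edges 4 28"
  by (rule all_solvable_blanusa1_if_weights[where L = 42 and qs =
    "[(4, (!) [16, 0, 0, 0, 0, 32, 0, 0, 0, 0, 2, 2, 4, 2, 2, 4, 8, 0]),
      (2, (!) [0, 8, 16, 32, 0, 0, 0, 0, 0, 0, 2, 0, 2, 4, 8, 4, 2, 0]),
      (2, (!) [0, 16, 8, 0, 0, 0, 8, 16, 0, 1, 2, 4, 2, 2, 4, 2, 1, 32]),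
      (5, (!) [0, 0, 0, 32, 0, 0, 0, 0, 16, 8, 4, 2, 2, 4, 2, 2, 0, 0]),
      (2, (!) [0, 0, 0, 0, 0, 32, 16, 8, 0, 2, 4, 8, 4, 2, 0, 2, 2, 0])]"])
    (simp_all add: blanusa1_verts_eq blanusa1_nbrs_def)

lemma all_solvable_blanusa1_9: "all_solvable blanusa1_verts blanusa1_edges 9 28"
  by (rule all_solvable_blanusa1_if_weights[where L = 16 and qs =
    "[(1, (!) [2, 4, 0, 0, 4, 2, 0, 16, 32, 0, 0, 0, 0, 0, 0, 0, 0, 8]),
      (1, (!) [2, 4, 8, 16, 8, 4, 0, 0, 32, 0, 0, 0, 0, 0, 0, 0, 0, 4]),
      (1, (!) [4, 4, 8, 0, 0, 2, 0, 0, 0, 0, 0, 0, 16, 32, 16, 0, 8, 2]),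
      (2, (!) [4, 2, 0, 0, 2, 4, 8, 0, 0, 0, 32, 16, 0, 0, 0, 16, 8, 1])]"])
    (simp_all add: blanusa1_verts_eq blanusa1_nbrs_def)

lemma all_solvable_blanusa1_10: "all_solvable blanusa1_verts blanusa1_edges 10 28"
  by (rule all_solvable_blanusa1_if_weights[where L = 30 and qs =
    "[(2, (!) [4, 2, 1, 0, 4, 8, 16, 8, 0, 0, 0, 32, 16, 8, 0, 0, 0, 4]),
      (2, (!) [8, 4, 2, 0, 2, 4, 0, 0, 0, 0, 0, 0, 0, 0, 0, 32, 16, 2]),
      (3, (!) [0, 2, 0, 8, 4, 2, 0, 8, 16, 32, 0, 0, 0, 0, 0, 0, 0, 4]),
      (3, (!) [2, 4, 8, 4, 2, 0, 0, 0, 0, 0, 0, 0, 0, 8, 16, 32, 0, 2])]"])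
    (simp_all add: blanusa1_verts_eq blanusa1_nbrs_def)

section \<open>Upper bound: the other roots by symmetry\<close>

text \<open>Being the identity outside the graph makes it an involution on all of
  \<open>nat\<close>, as the transport lemma requires.\<close>

definition blanusa1_aut1 :: "nat \<Rightarrow> nat" where
  "blanusa1_aut1 v =
     (if v < 18 then [0, 5, 6, 7, 17, 1, 2, 3, 8, 9, 13, 14, 15, 10, 11, 12, 16, 4] ! v else v)"

definition blanusa1_aut2 :: "nat \<Rightarrow> nat" where
  "blanusa1_aut2 v =
     (if v < 18 then [2, 1, 0, 5, 4, 3, 8, 7, 6, 11, 10, 9, 13, 12, 16, 15, 14, 17] ! v else v)"

lemma all_solvable_blanusa1_aut1:
  assumes "all_solvable blanusa1_verts blanusa1_edges r t"
  shows "all_solvable blanusa1_verts blanusa1_edges (blanusa1_aut1 r) t"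
proof (rule all_solvable_automorphism[OF _ _ _ assms])
  show "blanusa1_aut1 (blanusa1_aut1 x) = x" for x
  proof (cases "x < 18")
    case True
    then have "x \<in> blanusa1_verts"
      by (auto simp: blanusa1_verts_def)
    then show ?thesis
      unfolding blanusa1_verts_eq by (elim insertE emptyE) (simp_all add: blanusa1_aut1_def)
  next
    case False
    then show ?thesis
      by (simp add: blanusa1_aut1_def)
  qed
  show "blanusa1_aut1 ` e \<in> blanusa1_edges" if "e \<in> blanusa1_edges" for e
    using that unfolding blanusa1_edges_def
    by (elim insertE emptyE) (simp_all add: blanusa1_aut1_def doubleton_eq_iff)
  show "blanusa1_aut1 ` blanusa1_verts \<subseteq> blanusa1_verts"
    by (simp add: blanusa1_verts_eq blanusa1_aut1_def)
qed

lemma all_solvable_blanusa1_aut2: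
  assumes "all_solvable blanusa1_verts blanusa1_edges r t"
  shows "all_solvable blanusa1_verts blanusa1_edges (blanusa1_aut2 r) t"
proof (rule all_solvable_automorphism[OF _ _ _ assms])
  show "blanusa1_aut2 (blanusa1_aut2 x) = x" for x
  proof (cases "x < 18")
    case True
    then have "x \<in> blanusa1_verts"
      by (auto simp: blanusa1_verts_def)
    then show ?thesis
      unfolding blanusa1_verts_eq by (elim insertE emptyE) (simp_all add: blanusa1_aut2_def)
  next
    case False
    then show ?thesis
      by (simp add: blanusa1_aut2_def)
  qed
  show "blanusa1_aut2 ` e \<in> blanusa1_edges" if "e \<in> blanusa1_edges" for e
    using that unfolding blanusa1_edges_def
    by (elim insertE emptyE) (simp_all add: blanusa1_aut2_def doubleton_eq_iff)
  show "blanusa1_aut2 ` blanusa1_verts \<subseteq> blanusa1_verts"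
    by (simp add: blanusa1_verts_eq blanusa1_aut2_def)
qed

text \<open>Applying the two involutions alternately runs through the orbits 0, 2, 6, 8; then 1, 5,
  3, 7; then 4, 17; then 9, 11, 14, 16; then 10, 13, 12, 15.\<close>

lemma all_solvable_blanusa1:
  assumes "r \<in> blanusa1_verts"
  shows "all_solvable blanusa1_verts blanusa1_edges r 28"
proof -
  let ?P = "\<lambda>r. all_solvable blanusa1_verts blanusa1_edges r 28"
  note aut1 = all_solvable_blanusa1_aut1[where t = 28]
  note aut2 = all_solvable_blanusa1_aut2[where t = 28]
  have r2: "?P 2"
    using aut2[OF all_solvable_blanusa1_0] by (simp add: blanusa1_aut2_def)
  have r6: "?P 6"
    using aut1[OF r2] by (simp add: blanusa1_aut1_def)
  have r8: "?P 8"
    using aut2[OF r6] by (simp add: blanusa1_aut2_def)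
  have r5: "?P 5"
    using aut1[OF all_solvable_blanusa1_1] by (simp add: blanusa1_aut1_def)
  have r3: "?P 3"
    using aut2[OF r5] by (simp add: blanusa1_aut2_def)
  have r7: "?P 7"
    using aut1[OF r3] by (simp add: blanusa1_aut1_def)
  have r17: "?P 17"
    using aut1[OF all_solvable_blanusa1_4] by (simp add: blanusa1_aut1_def)
  have r11: "?P 11"
    using aut2[OF all_solvable_blanusa1_9] by (simp add: blanusa1_aut2_def)
  have r14: "?P 14"
    using aut1[OF r11] by (simp add: blanusa1_aut1_def)
  have r16: "?P 16"
    using aut2[OF r14] by (simp add: blanusa1_aut2_def)
  have r13: "?P 13"
    using aut1[OF all_solvable_blanusa1_10] by (simp add: blanusa1_aut1_def)
  have r12: "?P 12"
    using aut2[OF r13] by (simp add: blanusa1_aut2_def)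
  have r15: "?P 15"
    using aut1[OF r12] by (simp add: blanusa1_aut1_def)
  show ?thesis
    using assms all_solvable_blanusa1_0 all_solvable_blanusa1_1 all_solvable_blanusa1_4
      all_solvable_blanusa1_9 all_solvable_blanusa1_10
      r2 r6 r8 r5 r3 r7 r17 r11 r14 r16 r13 r12 r15
    unfolding blanusa1_verts_eq by (elim insertE emptyE) simp_all
qed

section \<open>Lower bound: an unsolvable distribution of size 22\<close>

text \<open>Its support is the set of vertices farthest from 4, at distance 4. The potentials used
  for the targets 3, 5, 17 start at 31, 31, 22, below the threshold 32.\<close>

definition blanusa1_bad :: "nat \<Rightarrow> nat" where
  "blanusa1_bad = (\<lambda>_. 0)(10 := 1, 12 := 11, 13 := 9, 15 := 1)"

text \<open>Two pebbles on \<open>x\<close> alone would contribute \<open>m x\<close>, more than the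
  initial total, which never grows.\<close>

lemma blanusa1_bad_potential:
  assumes "(pebbling_move blanusa1_edges)\<^sup>*\<^sup>* blanusa1_bad C" "x \<in> blanusa1_verts"
    and "\<forall>v\<in>blanusa1_verts. M v \<le> m v \<and> m v \<le> 2 * M v \<and> (\<forall>u\<in>set (blanusa1_nbrs ! v). M u \<le> m v)"
    and "(\<Sum>v\<in>blanusa1_verts. paired_potential (m v) (M v) (blanusa1_bad v)) < m x"
  shows "C x < 2"
proof (rule ccontr)
  assume "\<not> C x < 2"
  then have "m x \<le> paired_potential (m x) (M x) (C x)"
    using assms(2,3) by (intro paired_potential_ge) auto
  also have "\<dots> \<le> (\<Sum>v\<in>blanusa1_verts. paired_potential (m v) (M v) (C v))"
    using assms(2) by (intro member_le_sum) (auto simp: blanusa1_verts_def)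
  also have "\<dots> \<le> (\<Sum>v\<in>blanusa1_verts. paired_potential (m v) (M v) (blanusa1_bad v))"
  proof (rule pebbling_moves_potential_le[OF simple_graph_blanusa1 _ _ assms(1)])
    show "M v \<le> m u" if "{u, v} \<in> blanusa1_edges" for u v
      using that assms(3) blanusa1_edge_iff simple_graph_edgeD[OF simple_graph_blanusa1 that] by blast
  qed (use assms(3) in blast)
  finally show False
    using assms(4) by simp
qed

lemma blanusa1_bad_unsolvable: "\<not> solvable blanusa1_edges 4 blanusa1_bad"
proof
  assume "solvable blanusa1_edges 4 blanusa1_bad"
  moreover have "blanusa1_bad 4 = 0"
    by (simp add: blanusa1_bad_def)
  ultimately obtain u C where reach: "(pebbling_move blanusa1_edges)\<^sup>*\<^sup>* blanusa1_bad C"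
    and u: "{u, 4} \<in> blanusa1_edges" "C u \<ge> 2"
    by (rule solvable_obtain_neighbour)
  txt \<open>
    The potentials start with \<open>M = 16\<close> and \<open>m = 32\<close> at the target and are halved with each step
    away from it, except that for the targets 3 and 5 the unpaired pebble on 10 (for 5 also the one
    on 15) is ignored. This forces larger values at 11 for the target 3 and at 9, 14 for the target 5.
  \<close>
  note potential_simps = blanusa1_verts_eq blanusa1_nbrs_def blanusa1_bad_def paired_potential_def
  have "C 3 < 2"
    by (rule blanusa1_bad_potential[OF reach, where
          m = "(!) [4, 8, 16, 32, 16, 8, 4, 8, 16, 8, 4, 4, 2, 4, 8, 4, 2, 8]" and
          M = "(!) [2, 4, 8, 16, 8, 4, 2, 4, 8, 4, 4, 2, 1, 2, 4, 2, 1, 4]"])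
      (simp_all add: potential_simps)
  moreover have "C 5 < 2"
    by (rule blanusa1_bad_potential[OF reach, where
          m = "(!) [16, 8, 4, 8, 16, 32, 16, 8, 4, 4, 4, 8, 4, 2, 4, 4, 8, 8]" and
          M = "(!) [8, 4, 2, 4, 8, 16, 8, 4, 2, 2, 4, 4, 2, 1, 2, 4, 4, 4]"])
      (simp_all add: potential_simps)
  moreover have "C 17 < 2"
    by (rule blanusa1_bad_potential[OF reach, where
          m = "(!) [8, 16, 8, 8, 16, 8, 8, 16, 8, 4, 2, 4, 2, 2, 4, 2, 4, 32]" and
          M = "(!) [4, 8, 4, 4, 8, 4, 4, 8, 4, 2, 1, 2, 1, 1, 2, 1, 2, 16]"])
      (simp_all add: potential_simps)
  ultimately show False
    using u blanusa1_edge_iff[of 4 u] by (auto simp: insert_commute blanusa1_verts_def blanusa1_nbrs_def)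
qed

lemma not_all_solvable_blanusa1: "\<not> all_solvable blanusa1_verts blanusa1_edges 4 22"
proof -
  have "pebble_distribution blanusa1_verts blanusa1_bad" "pebble_size blanusa1_verts blanusa1_bad = 22"
    by (auto simp: pebble_distribution_def pebble_size_def blanusa1_bad_def blanusa1_verts_eq)
  then show ?thesis
    using blanusa1_bad_unsolvable by (auto simp: all_solvable_def)
qed

theorem theorem1:
  "23 \<le> pebbling_number blanusa1_verts blanusa1_edges \<and>
   pebbling_number blanusa1_verts blanusa1_edges \<le> 28"
proof
  let ?R = "rooted_pebbling_number blanusa1_verts blanusa1_edges"
  have fin: "finite blanusa1_verts" and mem: "4 \<in> blanusa1_verts"
    by (simp_all add: blanusa1_verts_def)
  \<comment> \<open>The upper bound enters here too: it ensures that the \<open>LEAST\<close> for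
    the root 4 is attained.\<close>
  have "22 < ?R 4"
    by (rule rooted_pebbling_number_gt[OF fin all_solvable_blanusa1[OF mem] not_all_solvable_blanusa1])
  also have "?R 4 \<le> pebbling_number blanusa1_verts blanusa1_edges"
    unfolding pebbling_number_def using fin mem by (intro Max_ge) auto
  finally show "23 \<le> pebbling_number blanusa1_verts blanusa1_edges"
    by simp
  show "pebbling_number blanusa1_verts blanusa1_edges \<le> 28"
    unfolding pebbling_number_def using fin mem all_solvable_blanusa1
    by (subst Max_le_iff) (auto intro: rooted_pebbling_number_le)
qed

end
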